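(* Let $d,k\ge 1$ be integers, let $\Sigma\in\mathbb{R}^{d\times d}$ be a symmetric positive definite matrix, and let $\boldsymbol{\mu}_1,\dots,\boldsymbol{\mu}_k,\boldsymbol{\mu}_{\mathrm{out}}\in\mathbb{R}^d$ be arbitrary. Let $P^{\mathrm{in}}$ be the equal-weight Gaussian mixture $\frac1k\sum_{i=1}^k\mathcal{N}(\boldsymbol{\mu}_i,\Sigma)$ and let $P^{\mathrm{out}}=\mathcal{N}(\boldsymbol{\mu}_{\mathrm{out}},\Sigma)$. For $1\le i\le k$ put $\alpha_i:=\frac12 d_M(\boldsymbol{\mu}_i,\boldsymbol{\mu}_{\mathrm{out}})$. Then \[ \mathbb{E}_{\mathbf{x}\sim P^{\mathrm{out}}}\big(ES(\mathbf{x})\big)\le\sum_{i=1}^k\Big(\big(1-P^{\mathrm{out}}(B_{\alpha_i}(\boldsymbol{\mu}_{\mathrm{out}}))\big)+\exp\big(-\tfrac12\alpha_i^2\big)\Big) \] and \[ \mathbb{E}_{\mathbf{x}\sim P^{\mathrm{in}}}\big(ES(\mathbf{x})\big)-\mathbb{E}_{\mathbf{x}\sim P^{\mathrm{out}}}\big(ES(\mathbf{x})\big)\le\sum_{i=1}^k\alpha_i . \]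
   Context: For $\mathbf{u},\mathbf{v}\in\mathbb{R}^d$, the Mahalanobis distance with respect to $\Sigma$ is $d_M(\mathbf{u},\mathbf{v}):=\sqrt{(\mathbf{u}-\mathbf{v})^{\top}\Sigma^{-1}(\mathbf{u}-\mathbf{v})}$, and $B_r(\mathbf{u}):=\{\mathbf{x}\in\mathbb{R}^d : d_M(\mathbf{x},\mathbf{u})<r\}$ (empty if $r=0$). The score function $ES:\mathbb{R}^d\to\mathbb{R}$ is $ES(\mathbf{x})=\sum_{i=1}^k ES_i(\mathbf{x})$ with $ES_i(\mathbf{x})=\exp\big(-\tfrac12(\mathbf{x}-\boldsymbol{\mu}_i)^{\top}\Sigma^{-1}(\mathbf{x}-\boldsymbol{\mu}_i)\big)$. *)

theory Defs
  imports "HOL-Probability.Probability"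
begin

definition sym_pos_def :: "real^'d^'d \<Rightarrow> bool" where
  "sym_pos_def S \<longleftrightarrow> transpose S = S \<and> (\<forall>x. x \<noteq> 0 \<longrightarrow> x \<bullet> (S *v x) > 0)"

definition mahalanobis :: "real^'d^'d \<Rightarrow> real^'d \<Rightarrow> real^'d \<Rightarrow> real" where
  "mahalanobis S u v = sqrt ((u - v) \<bullet> (matrix_inv S *v (u - v)))"

definition mahalanobis_ball :: "real^'d^'d \<Rightarrow> real \<Rightarrow> real^'d \<Rightarrow> (real^'d) set" where
  "mahalanobis_ball S r u = {x. mahalanobis S x u < r}"

definition mvn_density :: "real^'d^'d \<Rightarrow> real^'d \<Rightarrow> real^'d \<Rightarrow> real" where
  "mvn_density S m x =
     exp (- (1/2) * ((x - m) \<bullet> (matrix_inv S *v (x - m)))) / sqrt ((2 * pi) ^ CARD('d) * det S)"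

definition mvn :: "real^'d^'d \<Rightarrow> real^'d \<Rightarrow> (real^'d) measure" where
  "mvn S m = density lborel (\<lambda>x. ennreal (mvn_density S m x))"

definition mvn_mixture :: "nat \<Rightarrow> real^'d^'d \<Rightarrow> (nat \<Rightarrow> real^'d) \<Rightarrow> (real^'d) measure" where
  "mvn_mixture k S \<mu> =
     measure_of UNIV (sets borel) (\<lambda>A. ennreal (1 / real k) * (\<Sum>i = 1..k. emeasure (mvn S (\<mu> i)) A))"

(* measure_of yields the null measure when its last argument is not countably additive;
   the lemma emeasure_mvn_mixture below shows that this does not happen here. *)

lemma sets_mvn [simp, measurable_cong]: "sets (mvn S m) = sets borel"
  by (simp add: mvn_def)

lemma space_mvn [simp]: "space (mvn S m) = UNIV"
  by (simp add: mvn_def)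

lemma sets_mvn_mixture [simp, measurable_cong]: "sets (mvn_mixture k S \<mu>) = sets borel"
  unfolding mvn_mixture_def using sets.sigma_sets_eq[of borel] by (simp add: sets_measure_of_conv)

lemma space_mvn_mixture [simp]: "space (mvn_mixture k S \<mu>) = UNIV"
  by (simp add: mvn_mixture_def space_measure_of_conv)

lemma emeasure_mvn_mixture:
  assumes "A \<in> sets borel"
  shows "emeasure (mvn_mixture k S \<mu>) A =
    ennreal (1 / real k) * (\<Sum>i = 1..k. emeasure (mvn S (\<mu> i)) A)"
proof (rule emeasure_measure_of[OF mvn_mixture_def])
  show "countably_additive (sets (mvn_mixture k S \<mu>))
     (\<lambda>A. ennreal (1 / real k) * (\<Sum>i = 1..k. emeasure (mvn S (\<mu> i)) A))"
  proof (rule countably_additiveI)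
    fix F :: "nat \<Rightarrow> (real^'a) set"
    assume F: "range F \<subseteq> sets (mvn_mixture k S \<mu>)" "disjoint_family F"
    have "(\<Sum>n. \<Sum>i = 1..k. emeasure (mvn S (\<mu> i)) (F n)) =
        (\<Sum>i = 1..k. \<Sum>n. emeasure (mvn S (\<mu> i)) (F n))"
      by (rule suminf_sum) auto
    also have "\<dots> = (\<Sum>i = 1..k. emeasure (mvn S (\<mu> i)) (\<Union>n. F n))"
      using F by (intro sum.cong refl suminf_emeasure) auto
    finally show "(\<Sum>n. ennreal (1 / real k) * (\<Sum>i = 1..k. emeasure (mvn S (\<mu> i)) (F n))) =
        ennreal (1 / real k) * (\<Sum>i = 1..k. emeasure (mvn S (\<mu> i)) (\<Union>n. F n))"
      by simp
  qed
qed (use assms in \<open>auto simp: positive_def\<close>)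

definition ES_comp :: "real^'d^'d \<Rightarrow> real^'d \<Rightarrow> real^'d \<Rightarrow> real" where
  "ES_comp S m x = exp (- (1/2) * ((x - m) \<bullet> (matrix_inv S *v (x - m))))"

definition ES :: "nat \<Rightarrow> real^'d^'d \<Rightarrow> (nat \<Rightarrow> real^'d) \<Rightarrow> real^'d \<Rightarrow> real" where
  "ES k S \<mu> x = (\<Sum>i = 1..k. ES_comp S (\<mu> i) x)"

end

theory Submission
  imports Defs
begin

text \<open>
  Factoring the inverse covariance as \<open>A\<^sup>T A\<close> turns the Mahalanobis distance into the Euclidean norm
  after applying \<open>A\<close>; the linear substitution \<open>A\<close> then reduces the normalisation of the Gaussian
  density to the product of one-dimensional Gaussian integrals.

  For the first bound, a point of the ball of radius \<open>\<alpha>\<^sub>i\<close> around \<open>\<mu>_out\<close> has distance at least \<open>\<alpha>\<^sub>i\<close>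
  from \<open>\<mu>\<^sub>i\<close>, so the \<open>i\<close>-th score is at most \<open>exp (- \<alpha>\<^sub>i\<^sup>2 / 2)\<close> there, and it is at most 1 elsewhere.

  For the second bound, the parallelogram law gives \<open>E\<^sub>m ES\<^sub>c = K exp (- d(m, c)\<^sup>2 / 4)\<close> with a constant
  \<open>K \<in> [0, 1]\<close> independent of the centres. Hence replacing \<open>\<mu>_out\<close> by any other centre increases the
  expectation of the \<open>i\<close>-th score by at most \<open>1 - exp (- \<alpha>\<^sub>i\<^sup>2) \<le> min(1, \<alpha>\<^sub>i\<^sup>2) \<le> \<alpha>\<^sub>i\<close>.
\<close>

section \<open>Linear substitutions in Lebesgue integrals\<close>

lemma bij_betw_axis_Basis: "bij_betw (\<lambda>i. axis i 1) UNIV (Basis :: (real^'n) set)"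
  by (auto simp: bij_betw_def inj_on_def axis_eq_axis Basis_vec_def)

lemma sum_Basis_vec: "(\<Sum>b\<in>(Basis :: (real^'n) set). f b) = (\<Sum>i\<in>UNIV. f (axis i 1))"
  by (rule sum.reindex_bij_betw[OF bij_betw_axis_Basis, symmetric])

lemma prod_Basis_vec: "(\<Prod>b\<in>(Basis :: (real^'n) set). f b) = (\<Prod>i\<in>UNIV. f (axis i 1))"
  by (rule prod.reindex_bij_betw[OF bij_betw_axis_Basis, symmetric])

text \<open>By Fubini the coordinate along \<open>m\<close> can be integrated innermost. There the
  shear is a translation by an amount fixed by the other coordinates, and Lebesgue measure on the
  line is translation invariant.\<close>

lemma nn_integral_lborel_shear:
  fixes g :: "'a::euclidean_space \<Rightarrow> ennreal"
  assumes [measurable]: "g \<in> borel_measurable borel"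
    and m: "m \<in> Basis" and n: "n \<in> Basis" and "m \<noteq> n"
  shows "(\<integral>\<^sup>+x. g (x + (x \<bullet> n) *\<^sub>R m) \<partial>lborel) = (\<integral>\<^sup>+x. g x \<partial>lborel)"
proof -
  interpret product_sigma_finite "\<lambda>_::'a. lborel :: real measure" ..
  \<comment> \<open>\<open>s x\<close> has coordinate 0 along \<open>m\<close>; \<open>split\<close>
    below is Fubini with that coordinate as the inner variable \<open>y\<close>.\<close>
  define s where "s x = (\<Sum>b\<in>Basis - {m}. x b *\<^sub>R b)" for x :: "'a \<Rightarrow> real"
  have split: "(\<integral>\<^sup>+x. h x \<partial>lborel) =
      (\<integral>\<^sup>+x. \<integral>\<^sup>+y. h (y *\<^sub>R m + s x) \<partial>lborel \<partial>(\<Pi>\<^sub>M b\<in>Basis - {m}. lborel))"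
    if [measurable]: "h \<in> borel_measurable borel" for h :: "'a \<Rightarrow> ennreal"
  proof -
    have B: "Basis = insert m (Basis - {m})"
      using m by auto
    have sum_upd: "(\<Sum>b\<in>Basis. (x(m := y)) b *\<^sub>R b) = y *\<^sub>R m + s x" for x :: "'a \<Rightarrow> real" and y
      by (subst sum.remove[OF finite_Basis m]) (auto simp: s_def intro!: sum.cong)
    have "(\<integral>\<^sup>+x. h x \<partial>lborel) =
        (\<integral>\<^sup>+x. h (\<Sum>b\<in>Basis. x b *\<^sub>R b) \<partial>(\<Pi>\<^sub>M b\<in>Basis. lborel))"
      by (subst lborel_eq) (simp add: nn_integral_distr)
    also have "\<dots> = (\<integral>\<^sup>+x. h (\<Sum>b\<in>Basis. x b *\<^sub>R b) \<partial>(\<Pi>\<^sub>M b\<in>insert m (Basis - {m}). lborel))"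
      using B by simp
    also have "\<dots> = (\<integral>\<^sup>+x. \<integral>\<^sup>+y. h (\<Sum>b\<in>Basis. (x(m := y)) b *\<^sub>R b) \<partial>lborel
        \<partial>(\<Pi>\<^sub>M b\<in>Basis - {m}. lborel))"
      by (rule product_nn_integral_insert) (auto simp flip: B)
    finally show ?thesis
      unfolding sum_upd .
  qed
  \<comment> \<open>Orthogonality keeps the size of the shift free of \<open>y\<close>. The factor 1
    in \<open>T\<close> produces the affine shape of \<open>nn_integral_real_affine\<close>.\<close>
  have "m \<bullet> n = 0"
    using m n \<open>m \<noteq> n\<close> by (simp add: inner_not_same_Basis)
  then have T: "y *\<^sub>R m + s x + ((y *\<^sub>R m + s x) \<bullet> n) *\<^sub>R m = (s x \<bullet> n + 1 * y) *\<^sub>R m + s x" for x y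
    by (simp add: algebra_simps)
  have "(\<integral>\<^sup>+y. g ((s x \<bullet> n + 1 * y) *\<^sub>R m + s x) \<partial>lborel) = (\<integral>\<^sup>+y. g (y *\<^sub>R m + s x) \<partial>lborel)" for x
    by (subst (2) nn_integral_real_affine[where c=1 and t="s x \<bullet> n"]) auto
  then show ?thesis
    by (simp only: split[of g] split[of "\<lambda>x. g (x + (x \<bullet> n) *\<^sub>R m)", simplified] assms T)
qed

text \<open>Boxes determine \<open>lborel\<close>, and swapping coordinates only reorders the side
  lengths of a box, which preserves its volume.\<close>

lemma nn_integral_lborel_swap:
  fixes g :: "real^'n \<Rightarrow> ennreal"
  assumes [measurable]: "g \<in> borel_measurable borel"
  shows "(\<integral>\<^sup>+x. g (\<chi> i. x $ Transposition.transpose m n i) \<partial>lborel) = (\<integral>\<^sup>+x. g x \<partial>lborel)"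
proof -
  define T :: "real^'n \<Rightarrow> real^'n" where "T x = (\<chi> i. x $ Transposition.transpose m n i)" for x
  have "linear T"
    by (rule linearI) (simp_all add: T_def vec_eq_iff)
  then have [measurable]: "T \<in> borel_measurable borel"
    by (intro borel_measurable_continuous_onI linear_continuous_on linear_conv_bounded_linear[THEN iffD1])
  have "lborel = distr lborel borel T"
  proof (rule lborel_eqI)
    fix l u :: "real^'n"
    assume le: "\<And>b. b \<in> Basis \<Longrightarrow> l \<bullet> b \<le> u \<bullet> b"
    have le': "l $ i \<le> u $ i" for i
      using le[of "axis i 1"] by (simp add: inner_axis)
    \<comment> \<open>A transposition is its own inverse, so the corners of the preimage are the
      images of the corners.\<close>
    have "T -` box l u = box (T l) (T u)"
      by (auto simp: T_def mem_box_cart) (metis transpose_involutory)+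
    then have "emeasure (distr lborel borel T) (box l u) = emeasure lborel (box (T l) (T u))"
      by (simp add: emeasure_distr)
    also have "\<dots> = (\<Prod>b\<in>Basis. (T u - T l) \<bullet> b)"
      using le' by (intro emeasure_lborel_box) (auto simp: T_def Basis_vec_def inner_axis)
    also have "\<dots> = (\<Prod>i\<in>UNIV. (u - l) $ Transposition.transpose m n i)"
      by (simp add: prod_Basis_vec T_def inner_axis)
    also have "\<dots> = (\<Prod>i\<in>UNIV. (u - l) $ i)"
      by (subst prod.reindex_bij_betw[of "Transposition.transpose m n"]) (simp_all add: bij_swap)
    also have "\<dots> = (\<Prod>b\<in>Basis. (u - l) \<bullet> b)"
      by (simp add: prod_Basis_vec inner_axis)
    finally show "emeasure (distr lborel borel T) (box l u) = (\<Prod>b\<in>Basis. (u - l) \<bullet> b)" .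
  qed simp
  then have "(\<integral>\<^sup>+x. g x \<partial>lborel) = (\<integral>\<^sup>+x. g x \<partial>distr lborel borel T)"
    by simp
  then show ?thesis
    by (simp add: nn_integral_distr T_def)
qed

lemma nn_integral_lborel_stretch:
  fixes g :: "real^'n \<Rightarrow> ennreal"
  assumes [measurable]: "g \<in> borel_measurable borel" and c: "\<And>i. c i \<noteq> 0"
  shows "(\<integral>\<^sup>+x. g x \<partial>lborel) = ennreal \<bar>\<Prod>i\<in>UNIV. c i\<bar> * (\<integral>\<^sup>+x. g (\<chi> i. c i * x $ i) \<partial>lborel)"
proof -
  \<comment> \<open>\<open>d\<close> moves the factors from coordinates to basis vectors; the
    summand 0 in \<open>T\<close> is the translation in
    \<open>lborel_affine_euclidean\<close>.\<close>
  define d :: "real^'n \<Rightarrow> real" where "d b = c (axis_index b)" for b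
  define T :: "real^'n \<Rightarrow> real^'n" where "T x = 0 + (\<Sum>j\<in>Basis. (d j * (x \<bullet> j)) *\<^sub>R j)" for x
  have [measurable]: "T \<in> borel \<rightarrow>\<^sub>M borel"
    by (simp add: T_def[abs_def])
  have T: "T x = (\<chi> i. c i * x $ i)" for x
    unfolding T_def by (simp add: vec_eq_iff sum_Basis_vec d_def inner_axis)
      (simp add: axis_def if_distrib cong: if_cong)
  have d: "(\<Prod>j\<in>Basis. \<bar>d j\<bar>) = \<bar>\<Prod>i\<in>UNIV. c i\<bar>"
    by (simp add: prod_Basis_vec d_def abs_prod)
  have "lborel = density (distr lborel borel T) (\<lambda>_. (\<Prod>j\<in>Basis. \<bar>d j\<bar>))"
    unfolding T_def[abs_def] by (rule lborel_affine_euclidean) (simp add: d_def c)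
  then have "(\<integral>\<^sup>+x. g x \<partial>lborel) = (\<integral>\<^sup>+x. g x \<partial>density (distr lborel borel T) (\<lambda>_. (\<Prod>j\<in>Basis. \<bar>d j\<bar>)))"
    by simp
  also have "\<dots> = ennreal \<bar>\<Prod>i\<in>UNIV. c i\<bar> * (\<integral>\<^sup>+x. g (T x) \<partial>lborel)"
    by (simp add: nn_integral_density nn_integral_distr nn_integral_cmult d)
  finally show ?thesis
    unfolding T .
qed

text \<open>
  The change-of-variables theorems of \<^theory>\<open>HOL-Analysis.Change_Of_Vars\<close> require a well-ordered
  index type, which is not available for the arbitrary finite index type used here.
\<close>

lemma nn_integral_lborel_linear:
  fixes f :: "real^'n \<Rightarrow> real^'n" and g :: "real^'n \<Rightarrow> ennreal"
  assumes "linear f" and "det (matrix f) \<noteq> 0" and "g \<in> borel_measurable borel"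
  shows "(\<integral>\<^sup>+x. g x \<partial>lborel) = ennreal \<bar>det (matrix f)\<bar> * (\<integral>\<^sup>+x. g (f x) \<partial>lborel)"
proof -
  \<comment> \<open>Quantifying over \<open>g\<close> inside the induction predicate lets the
    composition case use the hypothesis for \<open>f\<close> at \<open>g\<close> and the one for
    \<open>h\<close> at \<open>\<lambda>x. g (f x)\<close>.\<close>
  have "det (matrix f) \<noteq> 0 \<longrightarrow> (\<forall>g \<in> borel_measurable borel.
      (\<integral>\<^sup>+x. g x \<partial>lborel) = ennreal \<bar>det (matrix f)\<bar> * (\<integral>\<^sup>+x. g (f x) \<partial>lborel))"
  proof (rule induct_linear_elementary[OF \<open>linear f\<close>]; intro impI ballI)
    fix f h :: "real^'n \<Rightarrow> real^'n" and g :: "real^'n \<Rightarrow> ennreal"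
    assume lin: "linear f" "linear h" and det: "det (matrix (f \<circ> h)) \<noteq> 0"
      and g [measurable]: "g \<in> borel_measurable borel"
      and f: "det (matrix f) \<noteq> 0 \<longrightarrow> (\<forall>g \<in> borel_measurable borel.
        (\<integral>\<^sup>+x. g x \<partial>lborel) = ennreal \<bar>det (matrix f)\<bar> * (\<integral>\<^sup>+x. g (f x) \<partial>lborel))"
      and h: "det (matrix h) \<noteq> 0 \<longrightarrow> (\<forall>g \<in> borel_measurable borel.
        (\<integral>\<^sup>+x. g x \<partial>lborel) = ennreal \<bar>det (matrix h)\<bar> * (\<integral>\<^sup>+x. g (h x) \<partial>lborel))"
    have eq: "det (matrix (f \<circ> h)) = det (matrix f) * det (matrix h)"
      by (simp add: matrix_compose lin det_mul)
    have [measurable]: "f \<in> borel_measurable borel"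
      using lin(1) by (intro borel_measurable_continuous_onI linear_continuous_on
          linear_conv_bounded_linear[THEN iffD1])
    have "(\<lambda>x. g (f x)) \<in> borel_measurable borel"
      by measurable
    with f h det g show "(\<integral>\<^sup>+x. g x \<partial>lborel) =
        ennreal \<bar>det (matrix (f \<circ> h))\<bar> * (\<integral>\<^sup>+x. g ((f \<circ> h) x) \<partial>lborel)"
      by (auto simp: eq abs_mult ennreal_mult mult.assoc)
  next
    fix f :: "real^'n \<Rightarrow> real^'n" and g :: "real^'n \<Rightarrow> ennreal" and i
    assume "linear f" "\<And>x. f x $ i = 0" "det (matrix f) \<noteq> 0"
    \<comment> \<open>A nonzero determinant forces surjectivity, but the image lies in a coordinate
      hyperplane: this case is contradictory.\<close>
    then have "surj f"
      by (metis det_nz_iff_inj linear_injective_imp_surjective)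
    then have False
      using \<open>\<And>x. f x $ i = 0\<close> by (metis one_neq_zero surjD vec_component)
    then show "(\<integral>\<^sup>+x. g x \<partial>lborel) = ennreal \<bar>det (matrix f)\<bar> * (\<integral>\<^sup>+x. g (f x) \<partial>lborel)" ..
  next
    fix c :: "'n \<Rightarrow> real" and g :: "real^'n \<Rightarrow> ennreal"
    let ?f = "\<lambda>x. \<chi> i. c i * x $ i"
    assume det: "det (matrix ?f) \<noteq> 0" and g: "g \<in> borel_measurable borel"
    have "det (matrix ?f) = (\<Prod>i\<in>UNIV. c i)"
      by (simp add: axis_def matrix_def det_diagonal)
    with det nn_integral_lborel_stretch[OF g, of c]
    show "(\<integral>\<^sup>+x. g x \<partial>lborel) = ennreal \<bar>det (matrix ?f)\<bar> * (\<integral>\<^sup>+x. g (?f x) \<partial>lborel)"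
      by simp
  next
    fix m n :: 'n and g :: "real^'n \<Rightarrow> ennreal"
    let ?f = "\<lambda>x::real^'n. \<chi> i. x $ Transposition.transpose m n i"
    assume g: "g \<in> borel_measurable borel"
    \<comment> \<open>A row permutation of the identity has determinant 1 or -1.\<close>
    have "matrix ?f = (\<chi> i. mat 1 $ Transposition.transpose m n i)"
      by (auto simp: vec_eq_iff matrix_def mat_def axis_def)
    then have "\<bar>det (matrix ?f)\<bar> = 1"
      by (simp add: det_permute_rows permutes_swap_id sign_swap_id abs_mult)
    then show "(\<integral>\<^sup>+x. g x \<partial>lborel) = ennreal \<bar>det (matrix ?f)\<bar> * (\<integral>\<^sup>+x. g (?f x) \<partial>lborel)"
      using nn_integral_lborel_swap[OF g, of m n] by simp
  next
    fix m n :: 'n and g :: "real^'n \<Rightarrow> ennreal"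
    let ?f = "\<lambda>x::real^'n. \<chi> i. if i = m then x $ m + x $ n else x $ i"
    assume "m \<noteq> n" and g: "g \<in> borel_measurable borel"
    \<comment> \<open>Adding one row of the identity to another leaves the determinant at 1; the map
      itself is the shear treated above.\<close>
    have "matrix ?f = (\<chi> k. if k = m then row m (mat 1) + 1 *s row n (mat 1) else row k (mat 1))"
      by (auto simp: vec_eq_iff matrix_def mat_def axis_def row_def)
    then have "det (matrix ?f) = 1"
      using det_row_operation[OF \<open>m \<noteq> n\<close>, of "mat 1" "1::real"] by simp
    moreover have "?f x = x + (x \<bullet> axis n 1) *\<^sub>R axis m 1" for x
      by (simp add: vec_eq_iff inner_axis) (simp add: axis_def)
    ultimately show "(\<integral>\<^sup>+x. g x \<partial>lborel) = ennreal \<bar>det (matrix ?f)\<bar> * (\<integral>\<^sup>+x. g (?f x) \<partial>lborel)"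
      using nn_integral_lborel_shear[OF g, of "axis m 1" "axis n 1"] \<open>m \<noteq> n\<close>
      by (simp add: axis_eq_axis)
  qed
  with assms show ?thesis
    by blast
qed

section \<open>Standard Gaussian integrals\<close>

lemma nn_integral_gaussian_real:
  "(\<integral>\<^sup>+t. ennreal (exp (- (1/2) * t\<^sup>2)) \<partial>lborel) = ennreal (sqrt (2 * pi))"
proof -
  have eq: "exp (- (1/2) * t\<^sup>2) = sqrt (2 * pi) * std_normal_density t" for t
    by (simp add: std_normal_density_def)
  have "(\<integral>\<^sup>+t. ennreal (std_normal_density t) \<partial>lborel) = 1"
    by (subst nn_integral_eq_integral) auto
  then show ?thesis
    unfolding eq by (simp add: ennreal_mult nn_integral_cmult)
qed

text \<open>The exponent is a sum over coordinates, so the integrand is a product and the integral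
  is a power of the one-dimensional one.\<close>

lemma nn_integral_gaussian_euclidean:
  "(\<integral>\<^sup>+x. ennreal (exp (- (1/2) * (x \<bullet> (x::'a::euclidean_space)))) \<partial>lborel) =
    ennreal (sqrt ((2 * pi) ^ DIM('a)))"
proof -
  have "ennreal (exp (- (1/2) * (x \<bullet> x))) = (\<Prod>b\<in>Basis. ennreal (exp (- (1/2) * (x \<bullet> b)\<^sup>2)))" for x :: 'a
    by (subst euclidean_inner) (simp add: prod_ennreal sum_distrib_left power2_eq_square sum_negf flip: exp_sum)
  then have "(\<integral>\<^sup>+x. ennreal (exp (- (1/2) * (x \<bullet> (x::'a)))) \<partial>lborel) =
      (\<Prod>b\<in>(Basis::'a set). \<integral>\<^sup>+t. ennreal (exp (- (1/2) * t\<^sup>2)) \<partial>lborel)"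
    by (simp only:) (rule nn_integral_lborel_prod, auto)
  then show ?thesis
    unfolding nn_integral_gaussian_real by (simp only: prod_constant real_sqrt_power) (simp add: ennreal_power)
qed

section \<open>Factoring the inverse covariance matrix\<close>

text \<open>Gram--Schmidt for the inner product \<^term>\<open>\<lambda>u v. u \<bullet> (S *v v)\<close>.\<close>

lemma sym_pos_def_orthonormal_family:
  fixes S :: "real^'d^'d"
  assumes S: "sym_pos_def S" and "n \<le> CARD('d)"
  shows "\<exists>f :: nat \<Rightarrow> real^'d. \<forall>i<n. \<forall>j<n. f i \<bullet> (S *v f j) = of_bool (i = j)"
  using \<open>n \<le> CARD('d)\<close>
proof (induction n)
  case (Suc n)
  then obtain f :: "nat \<Rightarrow> real^'d" where f: "\<And>i j. i < n \<Longrightarrow> j < n \<Longrightarrow> f i \<bullet> (S *v f j) = of_bool (i = j)"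
    by (metis Suc_leD)
  \<comment> \<open>Fewer vectors than the dimension cannot span, so there is a vector
    \<open>x\<close> left to orthogonalise.\<close>
  have "dim (span (f ` {..<n})) \<le> card (f ` {..<n})"
    by (simp add: dim_le_card')
  also have "\<dots> < DIM(real^'d)"
    using Suc.prems card_image_le[of "{..<n}" f] by simp
  finally have "span (f ` {..<n}) \<noteq> UNIV"
    by (metis dim_UNIV less_irrefl)
  then obtain x where x: "x \<notin> span (f ` {..<n})"
    by blast
  \<comment> \<open>\<open>y\<close> is \<open>x\<close> minus its projections with respect to
    \<open>S\<close>. It is nonzero because \<open>x\<close> lies outside the span, so positivity of
    \<open>S\<close> allows normalising it.\<close>
  define y where "y = x - (\<Sum>i<n. (f i \<bullet> (S *v x)) *\<^sub>R f i)"
  define g where "g = f(n := y /\<^sub>R sqrt (y \<bullet> (S *v y)))"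
  have "y \<noteq> 0"
  proof
    assume "y = 0"
    then have "x = (\<Sum>i<n. (f i \<bullet> (S *v x)) *\<^sub>R f i)"
      by (simp add: y_def)
    also have "\<dots> \<in> span (f ` {..<n})"
      by (intro span_sum span_scale span_base) auto
    finally show False
      using x by blast
  qed
  then have pos: "y \<bullet> (S *v y) > 0"
    using S by (simp add: sym_pos_def_def)
  have "f j \<bullet> (S *v y) = 0" if "j < n" for j
    using that f by (simp add: y_def matrix_vector_mult_diff_distrib linear_sum[OF matrix_vector_mul_linear]
        matrix_vector_mult_scaleR inner_diff_right inner_sum_right)
  moreover have "u \<bullet> (S *v v) = v \<bullet> (S *v u)" for u v
    using S by (metis sym_pos_def_def dot_lmul_matrix inner_commute transpose_matrix_vector)
  moreover have "inverse (sqrt (y \<bullet> (S *v y))) * (inverse (sqrt (y \<bullet> (S *v y))) * (y \<bullet> (S *v y))) = 1"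
    using pos by (simp add: field_simps)
  ultimately have "g i \<bullet> (S *v g j) = of_bool (i = j)" if "i < Suc n" "j < Suc n" for i j
    using that f by (auto simp: g_def less_Suc_eq matrix_vector_mult_scaleR)
  then show ?case
    by blast
qed simp

text \<open>\<open>matrix_inv\<close> chooses a two-sided inverse. A right inverse of a square
  matrix is also a left inverse, so such a choice exists and can only be \<open>B\<close>.\<close>

lemma matrix_inv_eqI:
  fixes A :: "real^'n^'n"
  assumes "A ** B = mat 1"
  shows "matrix_inv A = B"
proof -
  have "B ** A = mat 1"
    using assms by (simp add: matrix_left_right_inverse)
  with assms have "A ** matrix_inv A = mat 1"
    unfolding matrix_inv_def by (metis (mono_tags, lifting) someI_ex)
  with \<open>B ** A = mat 1\<close> show ?thesis
    by (metis matrix_mul_assoc matrix_mul_lid matrix_mul_rid)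
qed

text \<open>With an \<open>S\<close>-orthonormal basis as the rows of \<open>A\<close>, the product
  \<open>A ** (S ** transpose A)\<close> is the identity. Moving \<open>A\<close> to the right end
  gives the factorisation; taking determinants gives the second claim.\<close>

lemma sym_pos_def_inverse_factor:
  fixes S :: "real^'d^'d"
  assumes S: "sym_pos_def S"
  obtains A where "matrix_inv S = transpose A ** A" and "(det A)\<^sup>2 * det S = 1"
proof -
  obtain f :: "nat \<Rightarrow> real^'d"
    where f: "\<forall>i<CARD('d). \<forall>j<CARD('d). f i \<bullet> (S *v f j) = of_bool (i = j)"
    using sym_pos_def_orthonormal_family[OF S order_refl] by blast
  obtain h :: "'d \<Rightarrow> nat" where h: "bij_betw h UNIV {0..<CARD('d)}"
    using ex_bij_betw_finite_nat[OF finite_class.finite_UNIV] by blast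
  have hb: "h i < CARD('d)" and hi: "h i = h j \<longleftrightarrow> i = j" for i j
    using h by (auto simp: bij_betw_def inj_on_def)
  define A :: "real^'d^'d" where "A = (\<chi> i. f (h i))"
  have "(A ** (S ** transpose A)) $ i $ j = A $ i \<bullet> (S *v A $ j)" for i j
    by (simp add: matrix_matrix_mult_def matrix_vector_mult_def inner_vec_def transpose_def)
  then have one: "A ** (S ** transpose A) = mat 1"
    using f by (simp add: vec_eq_iff mat_def A_def hb hi)
  then have "S ** (transpose A ** A) = mat 1"
    by (metis matrix_left_right_inverse matrix_mul_assoc)
  then have "matrix_inv S = transpose A ** A"
    by (rule matrix_inv_eqI)
  moreover have "(det A)\<^sup>2 * det S = 1"
    using arg_cong[OF one, of det] by (simp add: det_mul power2_eq_square ac_simps)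
  ultimately show thesis
    by (rule that)
qed

section \<open>The Mahalanobis distance as a Euclidean norm\<close>

lemma inner_matrix_inv_factor:
  fixes S A :: "real^'d^'d"
  assumes "matrix_inv S = transpose A ** A"
  shows "x \<bullet> (matrix_inv S *v x) = (A *v x) \<bullet> (A *v x)"
  unfolding assms by (metis dot_lmul_matrix matrix_vector_mul_assoc transpose_matrix_vector transpose_transpose)

text \<open>A single \<open>A\<close> serves all three claims: the norm form transfers the metric
  laws, and the determinant is needed when substituting \<open>A\<close> in integrals.\<close>

lemma mahalanobis_norm_representation:
  fixes S :: "real^'d^'d"
  assumes "sym_pos_def S"
  shows "\<exists>A :: real^'d^'d. (\<forall>u v. mahalanobis S u v = norm (A *v u - A *v v)) \<and>
    (\<forall>m x. ES_comp S m x = exp (- (1/2) * (mahalanobis S x m)\<^sup>2)) \<and> (det A)\<^sup>2 * det S = 1"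
proof -
  obtain A where A: "matrix_inv S = transpose A ** A" "(det A)\<^sup>2 * det S = 1"
    using sym_pos_def_inverse_factor[OF assms] .
  have "mahalanobis S u v = norm (A *v u - A *v v)" for u v
    unfolding mahalanobis_def inner_matrix_inv_factor[OF A(1)]
    by (simp add: norm_eq_sqrt_inner matrix_vector_mult_diff_distrib)
  moreover have "ES_comp S m x = exp (- (1/2) * (norm (A *v x - A *v m))\<^sup>2)" for m x
    unfolding ES_comp_def inner_matrix_inv_factor[OF A(1)]
    by (simp add: power2_norm_eq_inner matrix_vector_mult_diff_distrib)
  ultimately show ?thesis
    using A(2) by (intro exI[of _ A]) simp
qed

lemma mahalanobis_commute:
  fixes S :: "real^'d^'d"
  assumes "sym_pos_def S"
  shows "mahalanobis S u v = mahalanobis S v u"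
proof -
  obtain A :: "real^'d^'d" where A: "\<And>u v. mahalanobis S u v = norm (A *v u - A *v v)"
    using mahalanobis_norm_representation[OF assms] by blast
  show ?thesis
    unfolding A by (rule norm_minus_commute)
qed

lemma mahalanobis_nonneg:
  fixes S :: "real^'d^'d"
  assumes "sym_pos_def S"
  shows "0 \<le> mahalanobis S u v"
proof -
  obtain A :: "real^'d^'d" where A: "\<And>u v. mahalanobis S u v = norm (A *v u - A *v v)"
    using mahalanobis_norm_representation[OF assms] by blast
  show ?thesis
    unfolding A by (rule norm_ge_zero)
qed

lemma mahalanobis_triangle:
  fixes S :: "real^'d^'d"
  assumes "sym_pos_def S"
  shows "mahalanobis S u w \<le> mahalanobis S u v + mahalanobis S v w"
proof -
  obtain A :: "real^'d^'d" where A: "\<And>u v. mahalanobis S u v = norm (A *v u - A *v v)"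
    using mahalanobis_norm_representation[OF assms] by blast
  show ?thesis
    unfolding A using norm_triangle_ineq[of "A *v u - A *v v" "A *v v - A *v w"] by simp
qed

section \<open>Score components: bounds, products and measurability\<close>

lemma ES_comp_eq_exp_mahalanobis:
  fixes S :: "real^'d^'d"
  assumes "sym_pos_def S"
  shows "ES_comp S m x = exp (- (1/2) * (mahalanobis S x m)\<^sup>2)"
  using mahalanobis_norm_representation[OF assms] by blast

lemma ES_comp_le_1: "sym_pos_def S \<Longrightarrow> ES_comp S m x \<le> 1"
  by (simp add: ES_comp_eq_exp_mahalanobis)

lemma ES_comp_pos: "0 < ES_comp S m x"
  by (simp add: ES_comp_def)

text \<open>The parallelogram law around the midpoint of \<open>m\<close> and \<open>c\<close>
  separates their mutual distance from \<open>x\<close>; halving its terms in the exponent gives the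
  1/4 and the square.\<close>

lemma ES_comp_mult:
  fixes S :: "real^'d^'d"
  assumes "sym_pos_def S"
  shows "ES_comp S m x * ES_comp S c x =
    exp (- (1/4) * (mahalanobis S m c)\<^sup>2) * (ES_comp S ((1/2) *\<^sub>R (m + c)) x)\<^sup>2"
proof -
  obtain A :: "real^'d^'d" where A: "\<And>u v. mahalanobis S u v = norm (A *v u - A *v v)"
    using mahalanobis_norm_representation[OF assms] by blast
  have parallelogram: "(mahalanobis S x m)\<^sup>2 + (mahalanobis S x c)\<^sup>2 =
      (1/2) * (mahalanobis S m c)\<^sup>2 + 2 * (mahalanobis S x ((1/2) *\<^sub>R (m + c)))\<^sup>2"
    unfolding A by (simp add: power2_norm_eq_inner matrix_vector_mult_scaleR
        matrix_vector_right_distrib algebra_simps inner_commute)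
  show ?thesis
    using parallelogram
    by (simp add: ES_comp_eq_exp_mahalanobis[OF assms] power2_eq_square[of "exp _"] flip: exp_add)
qed

lemma continuous_on_quadratic_form:
  "continuous_on UNIV (\<lambda>x. (x - m) \<bullet> ((B :: real^'d^'d) *v (x - m)))"
proof -
  have "continuous_on UNIV (\<lambda>x. B *v (x - m))"
    by (rule linear_continuous_on_compose) (intro continuous_intros matrix_vector_mul_linear)+
  then show ?thesis
    by (intro continuous_intros)
qed

lemma borel_measurable_ES_comp [measurable]: "ES_comp S m \<in> borel_measurable borel"
  unfolding ES_comp_def[abs_def]
  by (intro borel_measurable_continuous_onI continuous_on_exp continuous_on_mult_left
      continuous_on_quadratic_form)

lemma borel_measurable_ES [measurable]: "ES k S \<mu> \<in> borel_measurable borel"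
  unfolding ES_def[abs_def] by measurable

lemma mvn_density_eq: "mvn_density S m x = ES_comp S m x / sqrt ((2 * pi) ^ CARD('d) * det S)"
  for S :: "real^'d^'d"
  by (simp add: mvn_density_def ES_comp_def)

lemma borel_measurable_mvn_density [measurable]: "mvn_density S m \<in> borel_measurable borel"
  by (subst measurable_cong[OF mvn_density_eq]) measurable

lemma sets_mahalanobis_ball [measurable]: "mahalanobis_ball S r u \<in> sets borel"
proof -
  have "open (mahalanobis_ball S r u)"
    unfolding mahalanobis_ball_def mahalanobis_def
    by (intro open_Collect_less continuous_intros continuous_on_quadratic_form)
  then show ?thesis
    by simp
qed

section \<open>Normalisation of the Gaussian density\<close>

lemma det_sym_pos_def_pos:
  fixes S :: "real^'d^'d"
  assumes "sym_pos_def S"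
  shows "0 < det S"
proof -
  obtain A :: "real^'d^'d" where "matrix_inv S = transpose A ** A" and A: "(det A)\<^sup>2 * det S = 1"
    using sym_pos_def_inverse_factor[OF assms] .
  from A have "(det A)\<^sup>2 \<noteq> 0" and "0 < (det A)\<^sup>2 * det S"
    by auto
  then show ?thesis
    by (simp add: zero_less_mult_iff)
qed

lemma mvn_density_nonneg: "sym_pos_def S \<Longrightarrow> 0 \<le> mvn_density S m x"
  using det_sym_pos_def_pos[of S] ES_comp_pos[of S m x] by (simp add: mvn_density_eq)

lemma ES_comp_translate: "ES_comp S (a + m) (a + x) = ES_comp S m x"
  by (simp add: ES_comp_def)

text \<open>Moving the centre to 0 and substituting \<open>A\<close> leaves the standard Gaussian
  integral, scaled by the reciprocal of \<open>\<bar>det A\<bar>\<close>, which is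
  \<open>sqrt (det S)\<close>.\<close>

lemma nn_integral_ES_comp:
  fixes S :: "real^'d^'d"
  assumes S: "sym_pos_def S"
  shows "(\<integral>\<^sup>+x. ennreal (ES_comp S m x) \<partial>lborel) = ennreal (sqrt ((2 * pi) ^ CARD('d) * det S))"
proof -
  obtain A :: "real^'d^'d" where A: "\<And>u v. mahalanobis S u v = norm (A *v u - A *v v)"
      "\<And>m x. ES_comp S m x = exp (- (1/2) * (mahalanobis S x m)\<^sup>2)" "(det A)\<^sup>2 * det S = 1"
    using mahalanobis_norm_representation[OF S] by blast
  have det: "det A \<noteq> 0" "\<bar>det A\<bar> * sqrt (det S) = 1"
    using A(3) by (auto simp flip: real_sqrt_abs real_sqrt_mult)
  have "(\<integral>\<^sup>+x. ennreal (ES_comp S m x) \<partial>lborel) =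
      (\<integral>\<^sup>+x. ennreal (ES_comp S m x) \<partial>distr lborel borel ((+) m))"
    by (simp add: lborel_distr_plus)
  also have "\<dots> = (\<integral>\<^sup>+x. ennreal (ES_comp S (m + 0) (m + x)) \<partial>lborel)"
    by (simp add: nn_integral_distr)
  also have "\<dots> = (\<integral>\<^sup>+x. ennreal (exp (- (1/2) * ((A *v x) \<bullet> (A *v x)))) \<partial>lborel)" (is "_ = ?I")
    unfolding ES_comp_translate A(1,2) by (simp add: power2_norm_eq_inner)
  finally have I: "(\<integral>\<^sup>+x. ennreal (ES_comp S m x) \<partial>lborel) = ?I" .
  have "ennreal (sqrt ((2 * pi) ^ CARD('d))) = ennreal \<bar>det A\<bar> * ?I"
    using nn_integral_lborel_linear[of "(*v) A" "\<lambda>x. ennreal (exp (- (1/2) * (x \<bullet> x)))"]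
      nn_integral_gaussian_euclidean[where 'a = "real^'d"] det(1)
    by simp
  \<comment> \<open>Multiplying by \<open>sqrt (det S)\<close> cancels
    \<open>\<bar>det A\<bar>\<close> without a division in \<open>ennreal\<close>.\<close>
  then have "ennreal (sqrt (det S)) * ennreal (sqrt ((2 * pi) ^ CARD('d))) =
      ennreal (\<bar>det A\<bar> * sqrt (det S)) * ?I"
    using det_sym_pos_def_pos[OF S] by (simp add: ennreal_mult ac_simps)
  with det(2) I show ?thesis
    using det_sym_pos_def_pos[OF S] by (simp add: real_sqrt_mult ennreal_mult ac_simps)
qed

lemma prob_space_mvn:
  fixes S :: "real^'d^'d"
  assumes S: "sym_pos_def S"
  shows "prob_space (mvn S m)"
proof
  define Z where "Z = sqrt ((2 * pi) ^ CARD('d) * det S)"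
  have Z: "Z > 0"
    using det_sym_pos_def_pos[OF S] by (simp add: Z_def)
  have "emeasure (mvn S m) UNIV = (\<integral>\<^sup>+x. ennreal (mvn_density S m x) \<partial>lborel)"
    by (simp add: mvn_def emeasure_density)
  also have "\<dots> = (\<integral>\<^sup>+x. ennreal (1 / Z) * ennreal (ES_comp S m x) \<partial>lborel)"
    unfolding mvn_density_eq Z_def[symmetric]
    using Z ES_comp_pos[of S m] by (simp add: less_imp_le flip: ennreal_mult)
  also have "\<dots> = ennreal (1 / Z) * ennreal Z"
    by (simp add: nn_integral_cmult nn_integral_ES_comp[OF S] Z_def)
  also have "\<dots> = 1"
    using Z by (simp flip: ennreal_mult)
  finally show "emeasure (mvn S m) (space (mvn S m)) = 1"
    by simp
qed

section \<open>Expected scores under a Gaussian and under the mixture\<close>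

lemma integrable_ES_comp_mvn:
  assumes S: "sym_pos_def S"
  shows "integrable (mvn S m) (ES_comp S c)"
proof -
  interpret prob_space "mvn S m"
    by (rule prob_space_mvn[OF S])
  show ?thesis
    using ES_comp_pos[of S c] ES_comp_le_1[OF S, of c]
    by (intro integrable_const_bound[where B=1]) (auto simp: less_imp_le)
qed

lemma integrable_ES_mvn: "sym_pos_def S \<Longrightarrow> integrable (mvn S m) (ES k S \<mu>)"
  unfolding ES_def[abs_def] by (intro Bochner_Integration.integrable_sum integrable_ES_comp_mvn)

lemma integral_ES_mvn:
  "sym_pos_def S \<Longrightarrow> integral\<^sup>L (mvn S m) (ES k S \<mu>) = (\<Sum>i = 1..k. integral\<^sup>L (mvn S m) (ES_comp S (\<mu> i)))"
  unfolding ES_def[abs_def] by (intro Bochner_Integration.integral_sum integrable_ES_comp_mvn)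

lemma integral_mvn:
  assumes "sym_pos_def S" and [measurable]: "f \<in> borel_measurable borel"
  shows "integral\<^sup>L (mvn S m) f = (\<integral>x. mvn_density S m x * f x \<partial>lborel)"
  unfolding mvn_def using assms mvn_density_nonneg[OF assms(1)] by (subst integral_density) auto

text \<open>After \<open>ES_comp_mult\<close> the centres survive only in the exponential factor and
  in the midpoint \<open>?h\<close>; translation invariance removes the midpoint.\<close>

lemma integral_mvn_ES_comp:
  fixes S :: "real^'d^'d"
  assumes S: "sym_pos_def S"
  shows "integral\<^sup>L (mvn S m) (ES_comp S c) =
    exp (- (1/4) * (mahalanobis S m c)\<^sup>2) * integral\<^sup>L (mvn S 0) (ES_comp S 0)"
proof -
  let ?Z = "sqrt ((2 * pi) ^ CARD('d) * det S)" and ?h = "(1/2) *\<^sub>R (m + c)"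
  have "integral\<^sup>L (mvn S m) (ES_comp S c) =
      (\<integral>x. exp (- (1/4) * (mahalanobis S m c)\<^sup>2) * ((ES_comp S ?h x)\<^sup>2 / ?Z) \<partial>lborel)"
    using ES_comp_mult[OF S, of m _ c] by (simp add: integral_mvn S mvn_density_eq)
  also have "\<dots> = exp (- (1/4) * (mahalanobis S m c)\<^sup>2) * (\<integral>x. (ES_comp S ?h x)\<^sup>2 / ?Z \<partial>lborel)"
    by simp
  also have "(\<integral>x. (ES_comp S ?h x)\<^sup>2 / ?Z \<partial>lborel) =
      (\<integral>x. (ES_comp S ?h x)\<^sup>2 / ?Z \<partial>distr lborel borel ((+) ?h))"
    by (simp only: lborel_distr_plus)
  also have "\<dots> = (\<integral>x. (ES_comp S 0 x)\<^sup>2 / ?Z \<partial>lborel)"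
    using ES_comp_translate[of S ?h 0] by (subst integral_distr) auto
  \<comment> \<open>Density and score at centre 0 are proportional, so their product is the squared
    score over the normaliser.\<close>
  also have "\<dots> = integral\<^sup>L (mvn S 0) (ES_comp S 0)"
    by (simp add: integral_mvn S mvn_density_eq power2_eq_square)
  finally show ?thesis .
qed

text \<open>Comparing values on Borel sets shows that the mixture has the averaged density
  \<open>p\<close>; linearity of the Lebesgue integral does the rest.\<close>

lemma integral_mvn_mixture:
  assumes S: "sym_pos_def S" and f [measurable]: "f \<in> borel_measurable borel"
    and int: "\<And>j. j \<in> {1..k} \<Longrightarrow> integrable (mvn S (\<mu> j)) f"
  shows "integral\<^sup>L (mvn_mixture k S \<mu>) f = (1 / real k) * (\<Sum>j = 1..k. integral\<^sup>L (mvn S (\<mu> j)) f)"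
proof -
  define p where "p x = (1 / real k) * (\<Sum>j = 1..k. mvn_density S (\<mu> j) x)" for x
  have [measurable]: "p \<in> borel_measurable borel"
    unfolding p_def[abs_def] by measurable
  have p0: "0 \<le> p x" for x
    by (simp add: p_def sum_nonneg mvn_density_nonneg[OF S])
  have "mvn_mixture k S \<mu> = density lborel p"
  proof (rule measure_eqI)
    fix X
    assume "X \<in> sets (mvn_mixture k S \<mu>)"
    then have X [measurable]: "X \<in> sets borel"
      by simp
    have p: "ennreal (p x) * indicator X x =
        ennreal (1 / real k) * (\<Sum>j = 1..k. ennreal (mvn_density S (\<mu> j) x) * indicator X x)" for x
    proof -
      have "ennreal (p x) = ennreal (1 / real k) * (\<Sum>j = 1..k. ennreal (mvn_density S (\<mu> j) x))"
        unfolding p_def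
        by (subst ennreal_mult) (simp_all add: sum_nonneg sum_ennreal mvn_density_nonneg[OF S])
      then show ?thesis
        by (cases "x \<in> X") simp_all
    qed
    show "emeasure (mvn_mixture k S \<mu>) X = emeasure (density lborel p) X"
      by (simp add: emeasure_mvn_mixture mvn_def emeasure_density p nn_integral_cmult nn_integral_sum
          del: sum_mult_indicator)
  qed simp
  then have "integral\<^sup>L (mvn_mixture k S \<mu>) f = (\<integral>x. p x * f x \<partial>lborel)"
    using p0 by (simp add: integral_density)
  also have "\<dots> = (\<integral>x. (1 / real k) * (\<Sum>j = 1..k. mvn_density S (\<mu> j) x * f x) \<partial>lborel)"
    by (simp add: p_def sum_distrib_right)
  also have "\<dots> = (1 / real k) * (\<Sum>j = 1..k. \<integral>x. mvn_density S (\<mu> j) x * f x \<partial>lborel)"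
    using int mvn_density_nonneg[OF S]
    by (subst integral_mult_right_zero, subst Bochner_Integration.integral_sum)
       (auto simp: mvn_def integrable_density)
  finally show ?thesis
    by (simp add: integral_mvn S)
qed

section \<open>The two bounds for a single component\<close>

lemma integral_mvn_ES_comp_le:
  assumes S: "sym_pos_def S" and \<alpha>: "\<alpha> = 1/2 * mahalanobis S c m"
  shows "integral\<^sup>L (mvn S m) (ES_comp S c) \<le>
    (1 - measure (mvn S m) (mahalanobis_ball S \<alpha> m)) + exp (- (1/2) * \<alpha>\<^sup>2)"
proof -
  interpret prob_space "mvn S m"
    by (rule prob_space_mvn[OF S])
  let ?B = "mahalanobis_ball S \<alpha> m"
  \<comment> \<open>The indicator pays for the points outside the ball, the exponential for those
    inside.\<close>
  have le: "ES_comp S c x \<le> indicator (- ?B) x + exp (- (1/2) * \<alpha>\<^sup>2)" for x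
  proof (cases "x \<in> ?B")
    case True
    \<comment> \<open>The centres are 2 \<alpha> apart, so a point closer than \<alpha> to
      \<open>m\<close> is at least \<alpha> away from \<open>c\<close>.\<close>
    have "2 * \<alpha> \<le> mahalanobis S x c + mahalanobis S x m"
      using mahalanobis_triangle[OF S, of c m x] by (simp add: \<alpha> mahalanobis_commute[OF S])
    with True have "\<alpha> \<le> mahalanobis S x c"
      by (simp add: mahalanobis_ball_def)
    moreover have "0 \<le> \<alpha>"
      by (simp add: \<alpha> mahalanobis_nonneg[OF S])
    ultimately show ?thesis
      using True by (simp add: ES_comp_eq_exp_mahalanobis[OF S] power_mono)
  next
    case False
    then show ?thesis
      using ES_comp_le_1[OF S, of c x] by (simp add: add_increasing2)
  qed
  have int: "integrable (mvn S m) (indicat_real (- ?B))"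
    by (rule integrable_real_indicator) (auto simp: emeasure_eq_measure)
  have "integral\<^sup>L (mvn S m) (ES_comp S c) \<le> (\<integral>x. indicator (- ?B) x + exp (- (1/2) * \<alpha>\<^sup>2) \<partial>mvn S m)"
    by (intro integral_mono integrable_ES_comp_mvn S le Bochner_Integration.integrable_add int) simp
  also have "\<dots> = prob (- ?B) + exp (- (1/2) * \<alpha>\<^sup>2)"
    using int prob_space by (subst Bochner_Integration.integral_add) auto
  also have "prob (- ?B) = 1 - prob ?B"
    using prob_compl[of ?B] by (simp add: Compl_eq_Diff_UNIV)
  finally show ?thesis .
qed

lemma one_minus_exp_neg_square_le:
  fixes a :: real
  assumes "0 \<le> a"
  shows "1 - exp (- a\<^sup>2) \<le> a"
proof (cases "a \<le> 1")
  case True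
  have "1 - exp (- a\<^sup>2) \<le> a\<^sup>2"
    using exp_ge_add_one_self[of "- a\<^sup>2"] by simp
  also have "\<dots> \<le> a"
    using assms True by (simp add: power2_eq_square mult_left_le)
  finally show ?thesis .
next
  case False
  then show ?thesis
    using exp_gt_zero[of "- a\<^sup>2"] by linarith
qed

text \<open>Scores lie between 0 and 1 and the measure is a probability; at centre 0 this confines
  the constant \<open>K\<close> of the next lemma.\<close>

lemma integral_mvn_ES_comp_bounds:
  assumes S: "sym_pos_def S"
  shows "0 \<le> integral\<^sup>L (mvn S m) (ES_comp S c)" and "integral\<^sup>L (mvn S m) (ES_comp S c) \<le> 1"
proof -
  interpret prob_space "mvn S m"
    by (rule prob_space_mvn[OF S])
  show "0 \<le> integral\<^sup>L (mvn S m) (ES_comp S c)"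
    by (intro Bochner_Integration.integral_nonneg less_imp_le[OF ES_comp_pos])
  show "integral\<^sup>L (mvn S m) (ES_comp S c) \<le> 1"
    by (intro integral_le_const integrable_ES_comp_mvn S AE_I2 ES_comp_le_1)
qed

text \<open>\<open>m'\<close> is arbitrary so that every mixture mean can take its place: its
  exponential factor is bounded by 1 wherever it lies.\<close>

lemma integral_mvn_ES_comp_diff_le:
  assumes S: "sym_pos_def S" and \<alpha>: "\<alpha> = 1/2 * mahalanobis S c m"
  shows "integral\<^sup>L (mvn S m') (ES_comp S c) - integral\<^sup>L (mvn S m) (ES_comp S c) \<le> \<alpha>"
proof -
  define K where "K = integral\<^sup>L (mvn S 0) (ES_comp S 0)"
  have K: "0 \<le> K" "K \<le> 1"
    unfolding K_def using integral_mvn_ES_comp_bounds[OF S] by blast+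
  \<comment> \<open>Since \<alpha> is half the distance, the exponent at \<open>m\<close> is exactly
    minus the square of \<alpha>.\<close>
  have "(1/4) * (mahalanobis S m c)\<^sup>2 = \<alpha>\<^sup>2"
    by (simp add: \<alpha> mahalanobis_commute[OF S, of m c] power_divide)
  then have "integral\<^sup>L (mvn S m') (ES_comp S c) - integral\<^sup>L (mvn S m) (ES_comp S c) =
      (exp (- (1/4) * (mahalanobis S m' c)\<^sup>2) - exp (- \<alpha>\<^sup>2)) * K"
    unfolding integral_mvn_ES_comp[OF S, of _ c] K_def[symmetric] by (simp add: algebra_simps)
  also have "\<dots> \<le> (1 - exp (- \<alpha>\<^sup>2)) * K"
    using K by (intro mult_right_mono) auto
  also have "\<dots> \<le> 1 - exp (- \<alpha>\<^sup>2)"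
    using K by (simp add: mult_left_le)
  also have "\<dots> \<le> \<alpha>"
    using mahalanobis_nonneg[OF S, of c m] \<alpha> by (intro one_minus_exp_neg_square_le) simp
  finally show ?thesis .
qed

section \<open>Summation over the components\<close>

theorem theorem1:
  fixes k :: nat
    and \<Sigma> :: "real^'d^'d"
    and \<mu> :: "nat \<Rightarrow> real^'d"
    and \<mu>_out :: "real^'d"
    and \<alpha> :: "nat \<Rightarrow> real"
  assumes "k \<ge> 1"
    and "sym_pos_def \<Sigma>"
    and "\<And>i. i \<in> {1..k} \<Longrightarrow> \<alpha> i = 1/2 * mahalanobis \<Sigma> (\<mu> i) \<mu>_out"
  shows "integral\<^sup>L (mvn \<Sigma> \<mu>_out) (ES k \<Sigma> \<mu>)
      \<le> (\<Sum>i = 1..k. (1 - measure (mvn \<Sigma> \<mu>_out) (mahalanobis_ball \<Sigma> (\<alpha> i) \<mu>_out))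
                      + exp (- (1/2) * (\<alpha> i)\<^sup>2))
    \<and> integral\<^sup>L (mvn_mixture k \<Sigma> \<mu>) (ES k \<Sigma> \<mu>) - integral\<^sup>L (mvn \<Sigma> \<mu>_out) (ES k \<Sigma> \<mu>)
      \<le> (\<Sum>i = 1..k. \<alpha> i)"
proof
  show "integral\<^sup>L (mvn \<Sigma> \<mu>_out) (ES k \<Sigma> \<mu>)
      \<le> (\<Sum>i = 1..k. (1 - measure (mvn \<Sigma> \<mu>_out) (mahalanobis_ball \<Sigma> (\<alpha> i) \<mu>_out))
                      + exp (- (1/2) * (\<alpha> i)\<^sup>2))"
    unfolding integral_ES_mvn[OF assms(2)]
    by (intro sum_mono integral_mvn_ES_comp_le assms)
  let ?out = "integral\<^sup>L (mvn \<Sigma> \<mu>_out) (ES k \<Sigma> \<mu>)"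
  \<comment> \<open>The bound does not depend on the mean \<open>\<mu> j\<close>, so it passes to
    the average over \<open>j\<close>; \<open>k \<ge> 1\<close> permits the division by
    \<open>real k\<close>.\<close>
  have "integral\<^sup>L (mvn \<Sigma> (\<mu> j)) (ES k \<Sigma> \<mu>) - ?out \<le> (\<Sum>i = 1..k. \<alpha> i)" for j
    unfolding integral_ES_mvn[OF assms(2)] sum_subtractf[symmetric]
    by (intro sum_mono integral_mvn_ES_comp_diff_le assms)
  then have "(\<Sum>j = 1..k. integral\<^sup>L (mvn \<Sigma> (\<mu> j)) (ES k \<Sigma> \<mu>) - ?out) \<le> real k * (\<Sum>i = 1..k. \<alpha> i)"
    using sum_bounded_above[of "{1..k}" _ "\<Sum>i = 1..k. \<alpha> i"] by simp
  then show "integral\<^sup>L (mvn_mixture k \<Sigma> \<mu>) (ES k \<Sigma> \<mu>) - ?out \<le> (\<Sum>i = 1..k. \<alpha> i)"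
    using assms(1) integral_mvn_mixture[OF assms(2) borel_measurable_ES integrable_ES_mvn[OF assms(2)]]
    by (simp add: sum_subtractf field_simps)
qed

end
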